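(* Let $n<p$ be positive integers, $F(\bm{\nu})=\sum_{i\in[I]}a_i\prod_{j\in[p]}\nu_j^{n_{i,j}}$ with $a_i\in\mathbb{R}$ and nonnegative integers $n_{i,j}$, $\bm{B}=(\bm{B}_1,\bm{B}_2)\in\mathbb{R}^{(p-n)\times p}$ with $\bm{B}_2\in\mathbb{R}^{(p-n)\times(p-n)}$ nonsingular, $\bm{c}\in\mathbb{R}^{p-n}$, and $\bm{l},\bm{u}\in\mathbb{R}^p$ with $l_j<u_j$ for all $j$, such that $\{\bm{\nu}:\bm{B}\bm{\nu}=\bm{c},\ \bm{l}\le\bm{\nu}\le\bm{u}\}$ has a point with $\bm{l}<\bm{\nu}<\bm{u}$. Put $$\bm{H}=\mathrm{diag}(\bm{u}-\bm{l})^{-1}\begin{pmatrix}\bm{I}\\-\bm{B}_2^{-1}\bm{B}_1\end{pmatrix}\in\mathbb{R}^{p\times n},\qquad \bm{w}=\mathrm{diag}(\bm{u}-\bm{l})^{-1}\left(\begin{pmatrix}\bm{0}\\\bm{B}_2^{-1}\bm{c}\end{pmatrix}-\bm{l}\right)\in\mathbb{R}^p.$$ Let $\tilde{a}_i$ ($i\in[I]$), $\tilde{b}$ be reals such that $F(\mathrm{diag}(\bm{u}-\bm{l})\bm{\lambda}+\bm{l})=\sum_{i\in[I]}\tilde{a}_i\prod_{j\in[p]}\lambda_j^{n_{i,j}}+\tilde{b}$ for all $\bm{\lambda}$, let $K$ be strictly larger than $F(\mathrm{diag}(\bm{u}-\bm{l})\bm{\lambda}+\bm{l})$ for all $\bm{\lambda}\in[\bm{0},\bm{1}]$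 of the form $\bm{\lambda}=\bm{H}\bm{\theta}+\bm{w}$, and set $$\phi(\bm{\lambda})=-\ln\Big(K-\big(\sum_{i\in[I]}\tilde{a}_i\prod_{j\in[p]}\lambda_j^{n_{i,j}}+\tilde{b}\big)\Big),\qquad f(\bm{\theta})=\phi(\bm{H}\bm{\theta}+\bm{w}).$$ Let $m_j$ be positive integers with $m_j\ge\max_{i\in[I]}n_{i,j}$, $j\in[p]$. If $G(\bm{x})=K-\big(\sum_{i\in[I]}\tilde{a}_i\prod_{j\in[p]}g_{i,j}(x_j)+\tilde{b}\big)$, where $g_{i,j}(x_j)=\frac{x_j(x_j-1)\cdots(x_j-n_{i,j}+1)}{m_j(m_j-1)\cdots(m_j-n_{i,j}+1)}$ if $n_{i,j}>0$ and $g_{i,j}(x_j)=1$ if $n_{i,j}=0$, then $$f(\bm{\theta})=-\ln\mathbb{E}_{\hat{p}_{\bm{x}}(\bm{\theta})}[G(\bm{X})]\qquad\text{for all }\bm{\theta}\in\mathbb{R}^n\text{ with }\bm{H}\bm{\theta}+\bm{w}\in(0,1)^p;$$ or, in terms of $\bm{\lambda}=\bm{H}\bm{\theta}+\bm{w}\in(0,1)^p$, $\phi(\bm{\lambda})=-\ln\mathbb{E}_{p_{\bm{x}}(\bm{\lambda})}[G(\bm{X})]$.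
   Context: $[n]:=\{1,\ldots,n\}$; $\mathrm{diag}(\bm{v})$ is the diagonal matrix with diagonal $\bm{v}$; vector inequalities and intervals are componentwise. $\bm{X}=(X_1,\ldots,X_p)$ is a vector of independent binomial random variables $X_j\sim\mathrm{Bin}(m_j,\lambda_j)$, with joint mass $p_{\bm{x}}(\bm{\lambda})=\prod_{j\in[p]}\frac{m_j!}{x_j!(m_j-x_j)!}\lambda_j^{x_j}(1-\lambda_j)^{m_j-x_j}$ for $\bm{x}\in\prod_{j\in[p]}\{0,\ldots,m_j\}$, and $\hat{p}_{\bm{x}}(\bm{\theta}):=p_{\bm{x}}(\bm{H}\bm{\theta}+\bm{w})$; $\mathbb{E}_{p}$ denotes the corresponding expectation. *)

theory Defs
  imports "HOL-Analysis.Analysis" "HOL-Probability.Probability"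
begin

text \<open>
  The coordinate set \<open>[p]\<close> is the type \<open>'n + 'q\<close>, with \<open>CARD('n) = n\<close> and \<open>CARD('q) = p - n\<close>:
  \<open>Inl\<close> indexes the first \<open>n\<close> coordinates and \<open>Inr\<close> the last \<open>p - n\<close>. As types are nonempty,
  the pairs \<open>(n, p)\<close> covered are exactly those with \<open>0 < n < p\<close>.
\<close>

definition diag :: "real ^ 'k \<Rightarrow> real ^ 'k ^ 'k" where
  "diag v = (\<chi> i j. if i = j then v $ i else 0)"

definition hblock :: "real ^ 'n ^ 'r \<Rightarrow> real ^ 'q ^ 'r \<Rightarrow> real ^ ('n + 'q) ^ 'r" where
  "hblock A B = (\<chi> i j. case j of Inl k \<Rightarrow> A $ i $ k | Inr k \<Rightarrow> B $ i $ k)"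

text \<open>Used for stacking matrices (vectors of rows) as well as column vectors.\<close>

definition vblock :: "'a ^ 'n \<Rightarrow> 'a ^ 'q \<Rightarrow> 'a ^ ('n + 'q)" where
  "vblock A B = (\<chi> i. case i of Inl k \<Rightarrow> A $ k | Inr k \<Rightarrow> B $ k)"

text \<open>
  \<open>binomials m lam\<close> is the joint law \<open>p\<^sub>x(lam)\<close> of independent \<open>X\<^sub>j \<sim> Bin(m\<^sub>j, lam\<^sub>j)\<close>. It is
  meaningful only for \<open>lam \<in> [0,1]\<^sup>p\<close>, as \<^const>\<open>binomial_pmf\<close> is. The default value \<open>0\<close> plays
  no role, since the product is over all of \<open>UNIV\<close>.
\<close>

definition binomials :: "('p::finite \<Rightarrow> nat) \<Rightarrow> real ^ 'p \<Rightarrow> ('p \<Rightarrow> nat) pmf" where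
  "binomials m lam = Pi_pmf UNIV 0 (\<lambda>j. binomial_pmf (m j) (lam $ j))"

lemma pmf_binomials:
  assumes "\<And>j. 0 \<le> lam $ j \<and> lam $ j \<le> 1"
  shows "pmf (binomials m lam) x =
    (if \<forall>j. x j \<le> m j
     then \<Prod>j\<in>UNIV. fact (m j) / (fact (x j) * fact (m j - x j))
            * (lam $ j) ^ x j * (1 - lam $ j) ^ (m j - x j)
     else 0)"
proof -
  have *: "pmf (binomials m lam) x =
      (\<Prod>j\<in>UNIV. real (m j choose x j) * (lam $ j) ^ x j * (1 - lam $ j) ^ (m j - x j))"
    unfolding binomials_def using assms by (subst pmf_Pi) auto
  show ?thesis
  proof (cases "\<forall>j. x j \<le> m j")
    case True
    then show ?thesis unfolding * by (auto simp: binomial_fact intro!: prod.cong)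
  next
    case False
    then obtain j where "m j < x j" by (auto simp: not_le)
    then have "\<exists>j\<in>UNIV. real (m j choose x j) * (lam $ j) ^ x j * (1 - lam $ j) ^ (m j - x j) = 0"
      by (intro bexI[of _ j]) (auto simp: binomial_eq_0)
    then show ?thesis unfolding * using False by (auto simp: prod_zero_iff)
  qed
qed

definition binomials_affine ::
  "('p::finite \<Rightarrow> nat) \<Rightarrow> real ^ 'n ^ 'p \<Rightarrow> real ^ 'p \<Rightarrow> real ^ 'n \<Rightarrow> ('p \<Rightarrow> nat) pmf" where
  "binomials_affine m H w \<theta> = binomials m (H *v \<theta> + w)"

end

theory Submission
  imports Defs
begin

text \<open>
  The factorial moments of the binomial law are explicit: if \<open>X \<sim> Bin(m, q)\<close> and \<open>r \<le> m\<close>, the ratio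
  of falling factorials of \<open>X\<close> and \<open>m\<close> equals \<open>(X choose r) / (m choose r)\<close>, whose expectation is
  \<open>q ^ r\<close>. By independence each monomial in \<open>lam\<close> is then the expectation of a product of such ratios,
  and linearity turns \<open>G\<close> into the polynomial under the logarithm.
\<close>

text \<open>Choosing k of m items and then r of those k amounts to choosing r of m and then k - r of
  the remaining m - r. Once \<open>(m choose r) * q ^ r\<close> is pulled out, what is left is the
  total mass of Bin(m - r, q).\<close>

lemma expectation_binomial_pmf_choose:
  fixes q :: real
  assumes q: "0 \<le> q" "q \<le> 1" and r: "r \<le> m"
  shows "measure_pmf.expectation (binomial_pmf m q) (\<lambda>k. real (k choose r)) = real (m choose r) * q ^ r"
proof -
  have "measure_pmf.expectation (binomial_pmf m q) (\<lambda>k. real (k choose r))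
      = (\<Sum>k\<le>m. real (k choose r) * pmf (binomial_pmf m q) k)"
    using q by (simp add: expectation_binomial_pmf' mult.commute)
  also have "\<dots> = (\<Sum>k\<in>{r..m}. real (k choose r) * pmf (binomial_pmf m q) k)"
    by (rule sum.mono_neutral_right) (auto simp: binomial_eq_0)
  also have "\<dots> = (\<Sum>k\<in>{r..m}. real (m choose r) * q ^ r *
                     (real ((m - r) choose (k - r)) * q ^ (k - r) * (1 - q) ^ (m - k)))"
  proof (rule sum.cong)
    fix k assume k: "k \<in> {r..m}"
    have "real (m choose k) * real (k choose r) = real (m choose r) * real ((m - r) choose (k - r))"
      using choose_mult[of r k m] k by (simp flip: of_nat_mult)
    moreover have "q ^ k = q ^ r * q ^ (k - r)"
      using k by (simp flip: power_add)
    ultimately show "real (k choose r) * pmf (binomial_pmf m q) k = real (m choose r) * q ^ r *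
                       (real ((m - r) choose (k - r)) * q ^ (k - r) * (1 - q) ^ (m - k))"
      using q by (simp add: algebra_simps)
  qed simp
  also have "\<dots> = real (m choose r) * q ^ r *
      (\<Sum>k\<in>{r..m}. real ((m - r) choose (k - r)) * q ^ (k - r) * (1 - q) ^ (m - k))"
    by (simp add: sum_distrib_left)
  \<comment> \<open>The shift k = i + r turns the exponent m - k into m - r - i, which gives the
    binomial expansion of (q + (1 - q)) ^ (m - r).\<close>
  also have "(\<Sum>k\<in>{r..m}. real ((m - r) choose (k - r)) * q ^ (k - r) * (1 - q) ^ (m - k))
      = (\<Sum>i\<le>m - r. real ((m - r) choose i) * q ^ i * (1 - q) ^ (m - r - i))"
    using r by (intro sum.reindex_bij_witness[of _ "\<lambda>i. i + r" "\<lambda>k. k - r"]) auto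
  also have "\<dots> = 1"
    using binomial_ring[of q "1 - q" "m - r"] by simp
  finally show ?thesis by simp
qed

text \<open>This includes k < r: the factor with s = k vanishes, and so does the binomial
  coefficient.\<close>

lemma prod_falling_eq_fact_choose: "(\<Prod>s<r. real k - real s) = fact r * real (k choose r)"
  by (simp add: binomial_gbinomial gbinomial_mult_fact lessThan_atLeast0)

text \<open>The common \<open>fact r\<close> cancels, and \<open>r \<le> m\<close> makes the
  denominator \<open>m choose r\<close> nonzero.\<close>

lemma expectation_binomial_pmf_falling:
  fixes q :: real
  assumes "0 \<le> q" "q \<le> 1" "r \<le> m"
  shows "measure_pmf.expectation (binomial_pmf m q)
           (\<lambda>k. (\<Prod>s<r. real k - real s) / (\<Prod>s<r. real m - real s)) = q ^ r"
  using assms by (simp add: prod_falling_eq_fact_choose expectation_binomial_pmf_choose)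

text \<open>Finite support makes every real function integrable, as linearity of the expectation
  demands.\<close>

lemma finite_set_pmf_binomials:
  fixes lam :: "real ^ 'p::finite"
  assumes "\<And>j. 0 \<le> lam $ j \<and> lam $ j \<le> 1"
  shows "finite (set_pmf (binomials m lam))"
  unfolding binomials_def using assms
  by (subst set_Pi_pmf) (auto intro!: finite_PiE_dflt simp: set_pmf_binomial_eq)

lemma expectation_binomials_polynomial:
  fixes lam :: "real ^ 'p::finite" and \<alpha> :: "'i \<Rightarrow> real" and e :: "'i \<Rightarrow> 'p \<Rightarrow> nat"
  assumes lam: "\<And>j. 0 \<le> lam $ j \<and> lam $ j \<le> 1"
    and e: "\<And>i j. i \<in> A \<Longrightarrow> e i j \<le> m j"
  shows "measure_pmf.expectation (binomials m lam)
           (\<lambda>x. C - ((\<Sum>i\<in>A. \<alpha> i * (\<Prod>j\<in>UNIV.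
              (\<Prod>s<e i j. real (x j) - real s) / (\<Prod>s<e i j. real (m j) - real s))) + b))
       = C - ((\<Sum>i\<in>A. \<alpha> i * (\<Prod>j\<in>UNIV. (lam $ j) ^ e i j)) + b)"
proof -
  have integrable: "integrable (measure_pmf (binomials m lam)) h" for h :: "('p \<Rightarrow> nat) \<Rightarrow> real"
    by (intro integrable_measure_pmf_finite finite_set_pmf_binomials lam)
  have monomial: "measure_pmf.expectation (binomials m lam) (\<lambda>x. \<Prod>j\<in>UNIV.
            (\<Prod>s<e i j. real (x j) - real s) / (\<Prod>s<e i j. real (m j) - real s))
      = (\<Prod>j\<in>UNIV. (lam $ j) ^ e i j)" if "i \<in> A" for i
  proof -
    have "measure_pmf.expectation (binomials m lam) (\<lambda>x. \<Prod>j\<in>UNIV.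
            (\<Prod>s<e i j. real (x j) - real s) / (\<Prod>s<e i j. real (m j) - real s))
        = (\<Prod>j\<in>UNIV. measure_pmf.expectation (binomial_pmf (m j) (lam $ j))
            (\<lambda>k. (\<Prod>s<e i j. real k - real s) / (\<Prod>s<e i j. real (m j) - real s)))"
      \<comment> \<open>Independence factors the expectation. Rewriting falling factorials as
        \<open>fact\<close> times \<open>choose\<close> shows that the factors are
        nonnegative.\<close>
      unfolding binomials_def using lam
      by (intro expectation_prod_Pi_pmf) (auto simp: prod_falling_eq_fact_choose)
    also have "\<dots> = (\<Prod>j\<in>UNIV. (lam $ j) ^ e i j)"
      using lam e[OF that] by (intro prod.cong expectation_binomial_pmf_falling) auto
    finally show ?thesis .
  qed
  show ?thesis
    \<comment> \<open>With \<open>prod_dividef\<close> active, the product over j of quotients would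
      be split and \<open>monomial\<close> would no longer match.\<close>
    by (simp add: integrable Bochner_Integration.integral_diff Bochner_Integration.integral_add
          Bochner_Integration.integral_sum monomial del: prod_dividef)
qed

theorem proposition5p1:
  fixes I :: nat
    and a a' :: "nat \<Rightarrow> real"
    and b' K :: real
    and e :: "nat \<Rightarrow> 'n::finite + 'q::finite \<Rightarrow> nat"
    and m :: "'n + 'q \<Rightarrow> nat"
    and F \<phi> :: "real ^ ('n + 'q) \<Rightarrow> real"
    and f :: "real ^ 'n \<Rightarrow> real"
    and B :: "real ^ ('n + 'q) ^ 'q"
    and B1 :: "real ^ 'n ^ 'q"
    and B2 :: "real ^ 'q ^ 'q"
    and c :: "real ^ 'q"
    and l u w :: "real ^ ('n + 'q)"
    and H :: "real ^ 'n ^ ('n + 'q)"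
    and g :: "nat \<Rightarrow> 'n + 'q \<Rightarrow> nat \<Rightarrow> real"
    and G :: "('n + 'q \<Rightarrow> nat) \<Rightarrow> real"
  assumes F: "\<And>\<nu>. F \<nu> = (\<Sum>i\<in>{1..I}. a i * (\<Prod>j\<in>UNIV. (\<nu> $ j) ^ e i j))"
    and B: "B = hblock B1 B2"
    and B2: "invertible B2"
    and lu: "\<And>j. l $ j < u $ j"
    and interior: "\<exists>\<nu>. B *v \<nu> = c \<and> (\<forall>j. l $ j < \<nu> $ j \<and> \<nu> $ j < u $ j)"
    and H: "H = matrix_inv (diag (u - l)) ** vblock (mat 1) (- (matrix_inv B2 ** B1))"
    and w: "w = matrix_inv (diag (u - l)) *v (vblock 0 (matrix_inv B2 *v c) - l)"
    and ab: "\<And>lam. F (diag (u - l) *v lam + l)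
               = (\<Sum>i\<in>{1..I}. a' i * (\<Prod>j\<in>UNIV. (lam $ j) ^ e i j)) + b'"
    and K: "\<And>lam. (\<forall>j. 0 \<le> lam $ j \<and> lam $ j \<le> 1) \<Longrightarrow> (\<exists>\<theta>. lam = H *v \<theta> + w)
               \<Longrightarrow> F (diag (u - l) *v lam + l) < K"
    and \<phi>: "\<And>lam. \<phi> lam = - ln (K - ((\<Sum>i\<in>{1..I}. a' i * (\<Prod>j\<in>UNIV. (lam $ j) ^ e i j)) + b'))"
    and f: "\<And>\<theta>. f \<theta> = \<phi> (H *v \<theta> + w)"
    and m_pos: "\<And>j. 0 < m j"
    and m_ge: "\<And>i j. i \<in> {1..I} \<Longrightarrow> e i j \<le> m j"
    and g: "\<And>i j k. g i j k =
               (if 0 < e i j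
                then (\<Prod>s<e i j. real k - real s) / (\<Prod>s<e i j. real (m j) - real s)
                else 1)"
    and G: "\<And>x. G x = K - ((\<Sum>i\<in>{1..I}. a' i * (\<Prod>j\<in>UNIV. g i j (x j))) + b')"
  shows "(\<forall>\<theta>. (\<forall>j. 0 < (H *v \<theta> + w) $ j \<and> (H *v \<theta> + w) $ j < 1) \<longrightarrow>
            f \<theta> = - ln (measure_pmf.expectation (binomials_affine m H w \<theta>) G))
       \<and> (\<forall>lam. (\<exists>\<theta>. lam = H *v \<theta> + w) \<longrightarrow> (\<forall>j. 0 < lam $ j \<and> lam $ j < 1) \<longrightarrow>
            \<phi> lam = - ln (measure_pmf.expectation (binomials m lam) G))"
proof -
  \<comment> \<open>For \<open>e i j = 0\<close> both products are empty and their quotient is 1, so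
    the case distinction in \<open>g\<close> disappears.\<close>
  have "g i j k = (\<Prod>s<e i j. real k - real s) / (\<Prod>s<e i j. real (m j) - real s)" for i j k
    by (simp add: g)
  then have G': "G = (\<lambda>x. K - ((\<Sum>i\<in>{1..I}. a' i * (\<Prod>j\<in>UNIV.
      (\<Prod>s<e i j. real (x j) - real s) / (\<Prod>s<e i j. real (m j) - real s))) + b'))"
    by (simp add: fun_eq_iff G)
  \<comment> \<open>Both conjuncts are instances of this pointwise equality, the first at
    \<open>lam = H *v \<theta> + w\<close>.\<close>
  have "\<phi> lam = - ln (measure_pmf.expectation (binomials m lam) G)"
    if "\<forall>j. 0 < lam $ j \<and> lam $ j < 1" for lam
    unfolding G' \<phi> using that m_ge
    by (subst expectation_binomials_polynomial) (auto intro: less_imp_le)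
  then show ?thesis
    unfolding f binomials_affine_def by blast
qed

end
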